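(* Let $\mathcal{C}$ be any hereditary class that is $f$-separable, let $G\in\mathcal{C}$ have $n$ vertices and diameter $D_G$. Then the capture time of $G$ with respect to the STT algorithm is bounded above by $O\big(D_G\cdot\frac{n}{f(n)}\big)$.
   Context: Zero-visibility Cops and Robbers on $G$: cops choose starting vertices, then the robber; in each round each cop stays or moves to an adjacent vertex (cops travel along edges), then the robber does likewise; the robber is invisible to the cops; capture occurs when a cop occupies the robber's vertex. The capture time with respect to a cop strategy is the maximum number of rounds until capture. $D_G$ is the maximum distance between two vertices of $G$. A set $S\subset V$ is an $(s,\alpha)$-separator of $G=(V,E)$ if $V=A\cup B\cup S$ with $A,B,S$ pairwise disjoint, $|S|\le s$, $|A|,|B|\le\alpha|V|$ and no edge joins $A$ and $B$. The separation number $\mathrm{s}(G)$ is the least $s$ such that every subgraph of $G$ has an $(s,2/3)$-separator. $\mathcal{C}$ is $f$-separable if every $n$-vertex $G\in\mathcal{C}$ has $\mathrm{s}(G)\le f(n)$; hereditary means closed under induced subgraphs. STT on an $n$-vertex $G$, using a separation algorithm $\mathcal{S}$ that returns for a graph $H\in\mathcal{C}$ with $m$ vertices a partition $(A,B,C)$ of $V(H)$ with $C$ an $(f(m),2/3)$-separator: it keeps Stack-B of pairs (vertex set, binary string index) and Stack-C of pairs (separator, index). Scheduler: push $(V(G),\varepsilon)$ on Stack-B, Stack-C empty. While Stack-B is nonempty: pop $(U,w)$; let $p$ be $w$ without its last character; if Stack-C is nonempty then, while $p$ differs from the index of the top of Stack-C, pop $(S,w')$ from Stack-C and remove the cops from $S$;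 then call Separate$(G[U],w,n)$. Separate$(H,w,n)$: if $|V(H)|\le f(n)$, place cops on all vertices of $H$ and then remove them; otherwise compute $(A,B,C)=\mathcal{S}(H)$, place cops on all vertices of $C$, push $(C,w)$ onto Stack-C, then push $(B,w\cdot0)$ and $(A,w\cdot1)$ onto Stack-B. Each placement of cops is realised by walking cops along paths of $G$ to the target vertices. *)

theory Defs
  imports "Graph_Theory.Graph_Theory" "HOL-Library.Extended_Nat" "HOL-Library.Extended_Real"
begin

text \<open>
  Finite simple graphs are the locale \<^locale>\<open>graph\<close>: loop-free finite symmetric
  digraphs without parallel arcs, an undirected edge being a pair of opposite arcs.
  Distances are taken in the extended reals, so a disconnected graph has infinite diameter.
\<close>

definition distance :: "('a, 'b) pre_digraph \<Rightarrow> 'a \<Rightarrow> 'a \<Rightarrow> ereal" where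
  "distance G u v = wf_digraph.\<mu> G (\<lambda>_. 1) u v"

definition diameter :: "('a, 'b) pre_digraph \<Rightarrow> ereal" where
  "diameter G = (SUP u \<in> verts G. SUP v \<in> verts G. distance G u v)"

definition shortest_walk :: "('a, 'b) pre_digraph \<Rightarrow> 'a \<Rightarrow> 'b awalk \<Rightarrow> 'a \<Rightarrow> bool" where
  "shortest_walk G u p v \<longleftrightarrow>
     pre_digraph.awalk G u p v \<and> ereal (real (length p)) = distance G u v"


section \<open>Separators\<close>

definition separation ::
    "('a, 'b) pre_digraph \<Rightarrow> real \<Rightarrow> real \<Rightarrow> 'a set \<Rightarrow> 'a set \<Rightarrow> 'a set \<Rightarrow> bool" where
  "separation G s \<alpha> A B S \<longleftrightarrow>
     verts G = A \<union> B \<union> S \<and> A \<inter> B = {} \<and> A \<inter> S = {} \<and> B \<inter> S = {} \<and>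
     real (card S) \<le> s \<and>
     real (card A) \<le> \<alpha> * real (card (verts G)) \<and>
     real (card B) \<le> \<alpha> * real (card (verts G)) \<and>
     (\<forall>a \<in> A. \<forall>b \<in> B. \<not> (a \<rightarrow>\<^bsub>G\<^esub> b) \<and> \<not> (b \<rightarrow>\<^bsub>G\<^esub> a))"

definition separator :: "('a, 'b) pre_digraph \<Rightarrow> real \<Rightarrow> real \<Rightarrow> 'a set \<Rightarrow> bool" where
  "separator G s \<alpha> S \<longleftrightarrow> (\<exists>A B. separation G s \<alpha> A B S)"

text \<open>
  The library relation \<^const>\<open>subgraph\<close> is about digraphs; requiring \<^term>\<open>graph H\<close> in
  addition restricts it to subgraphs of the undirected graph.
\<close>

definition separation_number :: "('a, 'b) pre_digraph \<Rightarrow> nat" where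
  "separation_number G =
     (LEAST s. \<forall>H. graph H \<and> subgraph H G \<longrightarrow> (\<exists>S. separator H (real s) (2/3) S))"

definition separable :: "(nat \<Rightarrow> real) \<Rightarrow> ('a, 'b) pre_digraph set \<Rightarrow> bool" where
  "separable f \<C> \<longleftrightarrow>
     (\<forall>G \<in> \<C>. real (separation_number G) \<le> f (card (verts G)))"

definition hereditary :: "('a, 'b) pre_digraph set \<Rightarrow> bool" where
  "hereditary \<C> \<longleftrightarrow>
     (\<forall>G \<in> \<C>. \<forall>U. U \<noteq> {} \<and> U \<subseteq> verts G \<longrightarrow> G \<restriction> U \<in> \<C>)"

definition separation_algorithm ::
    "('a, 'b) pre_digraph set \<Rightarrow> (nat \<Rightarrow> real) \<Rightarrow>
     (('a, 'b) pre_digraph \<Rightarrow> 'a set \<times> 'a set \<times> 'a set) \<Rightarrow> bool" where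
  "separation_algorithm \<C> f \<S> \<longleftrightarrow>
     (\<forall>H \<in> \<C>. case \<S> H of (A, B, C) \<Rightarrow> separation H (f (card (verts H))) (2/3) A B C)"


section \<open>The zero-visibility game\<close>

text \<open>
  The cops are numbered \<open>0, \<dots>, k - 1\<close>. As they never see the robber, a cop strategy is a
  sequence \<open>\<sigma>\<close> of configurations fixed in advance: \<open>\<sigma> ! 0\<close> is the choice of starting vertices
  and \<open>\<sigma> ! t\<close> the configuration after the cops' move of round \<open>t\<close>. A robber play \<open>r\<close> lists the
  robber's vertex after his move of each round.
\<close>

type_synonym 'a config = "nat \<Rightarrow> 'a"

definition robber_play :: "('a, 'b) pre_digraph \<Rightarrow> (nat \<Rightarrow> 'a) \<Rightarrow> bool" where
  "robber_play G r \<longleftrightarrow>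
     r 0 \<in> verts G \<and> (\<forall>t. r (Suc t) = r t \<or> r t \<rightarrow>\<^bsub>G\<^esub> r (Suc t))"

text \<open>
  In round \<open>t > 0\<close> a cop can meet the robber either by her own move, when he is still on
  \<open>r (t - 1)\<close>, or by his.
\<close>

definition captured_in :: "nat \<Rightarrow> 'a config list \<Rightarrow> (nat \<Rightarrow> 'a) \<Rightarrow> nat \<Rightarrow> bool" where
  "captured_in k \<sigma> r t \<longleftrightarrow>
     t < length \<sigma> \<and> (\<exists>c < k. (\<sigma> ! t) c = r t \<or> (0 < t \<and> (\<sigma> ! t) c = r (t - 1)))"

text \<open>A robber who is never caught contributes \<^term>\<open>\<infinity> :: enat\<close>.\<close>

definition capture_time :: "('a, 'b) pre_digraph \<Rightarrow> nat \<Rightarrow> 'a config list \<Rightarrow> enat" where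
  "capture_time G k \<sigma> =
     (SUP r \<in> {r. robber_play G r}. INF t \<in> {t. captured_in k \<sigma> r t}. enat t)"


section \<open>The algorithm STT\<close>

text \<open>
  The cops in \<open>Q\<close> are stationed on separators; every target \<open>v\<close> in \<open>T\<close> is assigned its own
  cop \<open>g v\<close> outside \<open>Q\<close>. The assigned cops walk simultaneously along shortest paths of \<open>G\<close>,
  each waiting at its target until the last one has arrived; all other cops stay put.
  The list \<open>ps\<close> collects the configurations of these rounds, without the initial one.
\<close>

definition placement ::
    "('a, 'b) pre_digraph \<Rightarrow> nat \<Rightarrow> nat set \<Rightarrow> 'a config \<Rightarrow> 'a set \<Rightarrow> ('a \<Rightarrow> nat) \<Rightarrow>
     'a config list \<Rightarrow> bool" where
  "placement G k Q pos T g ps \<longleftrightarrow>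
     inj_on g T \<and> g ` T \<subseteq> {..<k} - Q \<and>
     (\<exists>path.
        (\<forall>v \<in> T. shortest_walk G (pos (g v)) (path v) v) \<and>
        length ps = Max (insert 0 ((\<lambda>v. length (path v)) ` T)) \<and>
        (\<forall>j \<le> length ps.
           (\<forall>v \<in> T. ((pos # ps) ! j) (g v) =
              pre_digraph.awalk_verts G (pos (g v)) (path v) ! min j (length (path v))) \<and>
           (\<forall>c. c \<notin> g ` T \<longrightarrow> ((pos # ps) ! j) c = pos c)))"

text \<open>
  A state consists of Stack-B, Stack-C (heads of the lists are the tops), the set of cops
  stationed on the separators of Stack-C, and the current configuration. In the index strings
  \<^const>\<open>False\<close> and \<^const>\<open>True\<close> stand for the characters \<open>0\<close> and \<open>1\<close>.
\<close>

type_synonym 'a stack = "('a set \<times> bool list) list"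
type_synonym 'a state = "'a stack \<times> 'a stack \<times> nat set \<times> 'a config"

definition kept :: "bool list \<Rightarrow> 'a stack \<Rightarrow> 'a stack" where
  "kept p SC = dropWhile (\<lambda>(S, w'). w' \<noteq> p) SC"

definition stationed :: "bool list \<Rightarrow> 'a stack \<Rightarrow> nat set \<Rightarrow> 'a config \<Rightarrow> nat set" where
  "stationed p SC Q pos =
     {c \<in> Q. \<forall>(S, w') \<in> set (takeWhile (\<lambda>(S, w'). w' \<noteq> p) SC). pos c \<notin> S}"

text \<open>
  One iteration of the scheduler's loop; \<open>ps\<close> are the configurations of the rounds it takes.
  In rule \<open>small\<close> the cops placed on \<open>U\<close> are removed at once: they are not added to the
  stationed cops.
\<close>

inductive stt_step ::
    "('a, 'b) pre_digraph \<Rightarrow> (nat \<Rightarrow> real) \<Rightarrow>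
     (('a, 'b) pre_digraph \<Rightarrow> 'a set \<times> 'a set \<times> 'a set) \<Rightarrow> nat \<Rightarrow>
     'a state \<Rightarrow> 'a config list \<Rightarrow> 'a state \<Rightarrow> bool"
  for G :: "('a, 'b) pre_digraph" and f \<S> k where
  small:
    "\<lbrakk> real (card (verts (G \<restriction> U))) \<le> f (card (verts G));
       placement G k (stationed (butlast w) SC Q pos) pos (verts (G \<restriction> U)) g ps \<rbrakk>
     \<Longrightarrow> stt_step G f \<S> k ((U, w) # SB, SC, Q, pos) ps
           (SB, kept (butlast w) SC, stationed (butlast w) SC Q pos, last (pos # ps))"
| large:
    "\<lbrakk> \<not> real (card (verts (G \<restriction> U))) \<le> f (card (verts G));
       \<S> (G \<restriction> U) = (A, B, C);
       placement G k (stationed (butlast w) SC Q pos) pos C g ps \<rbrakk>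
     \<Longrightarrow> stt_step G f \<S> k ((U, w) # SB, SC, Q, pos) ps
           ((A, w @ [True]) # (B, w @ [False]) # SB,
            (C, w) # kept (butlast w) SC,
            stationed (butlast w) SC Q pos \<union> g ` C, last (pos # ps))"

inductive stt_run ::
    "('a, 'b) pre_digraph \<Rightarrow> (nat \<Rightarrow> real) \<Rightarrow>
     (('a, 'b) pre_digraph \<Rightarrow> 'a set \<times> 'a set \<times> 'a set) \<Rightarrow> nat \<Rightarrow>
     'a state \<Rightarrow> 'a config list \<Rightarrow> bool"
  for G :: "('a, 'b) pre_digraph" and f \<S> k where
  stop: "stt_run G f \<S> k ([], SC, Q, pos) []"
| step: "\<lbrakk> stt_step G f \<S> k st ps st'; stt_run G f \<S> k st' qs \<rbrakk>
         \<Longrightarrow> stt_run G f \<S> k st (ps @ qs)"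

text \<open>
  A strategy with \<open>k\<close> cops is an STT strategy if it arises from a complete run of the scheduler.
  The first placement is the cops' choice of starting vertices, hence takes no rounds.
\<close>

definition stt_strategy ::
    "('a, 'b) pre_digraph \<Rightarrow> (nat \<Rightarrow> real) \<Rightarrow>
     (('a, 'b) pre_digraph \<Rightarrow> 'a set \<times> 'a set \<times> 'a set) \<Rightarrow> nat \<Rightarrow> 'a config list \<Rightarrow> bool" where
  "stt_strategy G f \<S> k \<sigma> \<longleftrightarrow>
     (\<exists>pos st qs. (\<forall>c < k. pos c \<in> verts G) \<and>
        stt_step G f \<S> k ([(verts G, [])], [], {}, pos) [] st \<and>
        stt_run G f \<S> k st qs \<and>
        \<sigma> = pos # qs)"

end

theory Submission
  imports Defs
begin

text \<open>
  Invariantly, an uncaught robber sits in a block of Stack-B: the sets on the two stacks are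
  pairwise disjoint, every edge leaving a block leads to another block or to a separator on
  Stack-C, and all vertices of these separators are occupied. Hence the robber is caught when
  Stack-B is empty. The number of iterations is controlled by a potential: a block of size \<open>m\<close>
  has weight \<open>1\<close> if \<open>m \<le> f n\<close> and \<open>6 m / f n - 1\<close> otherwise, and every iteration lowers the
  total weight by at least \<open>1\<close> while lasting at most \<open>D\<^sub>G\<close> rounds. Since the first placement
  is free, a run with a single iteration lasts no rounds at all.
\<close>

section \<open>Course and duration of a placement\<close>

lemma placement_idle:
  assumes "placement G k Q pos T g ps" "c \<notin> g ` T" "j \<le> length ps"
  shows "((pos # ps) ! j) c = pos c"
  using assms unfolding placement_def by blast

text \<open>The placement lasts as long as its longest path, so in the final configuration
  \<open>min\<close> selects the last vertex of every path.\<close>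

lemma placement_target:
  assumes "wf_digraph G" "finite T" "placement G k Q pos T g ps" "v \<in> T"
  shows "last (pos # ps) (g v) = v"
proof -
  interpret wf_digraph G by (rule assms(1))
  from assms(3) obtain path where walk: "shortest_walk G (pos (g v)) (path v) v"
    and len: "length ps = Max (insert 0 ((\<lambda>v. length (path v)) ` T))"
    and eq: "\<And>j. j \<le> length ps \<Longrightarrow> ((pos # ps) ! j) (g v) =
      awalk_verts (pos (g v)) (path v) ! min j (length (path v))"
    using assms(4) unfolding placement_def by blast
  have "length (path v) \<le> length ps"
    unfolding len using assms(2,4) by (intro Max_ge) auto
  then have "last (pos # ps) (g v) =
      awalk_verts (pos (g v)) (path v) ! length (path v)"
    using eq[of "length ps"] by (simp add: last_conv_nth[of "pos # ps"] min_absorb2 del: last.simps)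
  also have "\<dots> = last (awalk_verts (pos (g v)) (path v))"
    by (simp add: last_conv_nth length_awalk_verts)
  also have "\<dots> = v"
    using walk unfolding shortest_walk_def by simp
  finally show ?thesis .
qed

lemma (in wf_digraph) distance_nonneg: "0 \<le> distance G u v"
  unfolding distance_def \<mu>_def
  by (auto intro!: INF_greatest pos_cost_pos_awalk_cost)

lemma distance_le_diameter:
  assumes "u \<in> verts G" "v \<in> verts G"
  shows "distance G u v \<le> diameter G"
  unfolding diameter_def using assms by (meson SUP_upper2 SUP_upper)

lemma placement_length:
  assumes "finite T" "T \<subseteq> verts G" "placement G k Q pos T g ps"
    and "diameter G = ereal d" "0 \<le> d"
  shows "real (length ps) \<le> d"
proof -
  from assms(3) obtain path where walk: "\<And>v. v \<in> T \<Longrightarrow> shortest_walk G (pos (g v)) (path v) v"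
    and len: "length ps = Max (insert 0 ((\<lambda>v. length (path v)) ` T))"
    unfolding placement_def by blast
  have "length ps \<in> insert 0 ((\<lambda>v. length (path v)) ` T)"
    unfolding len using assms(1) by (intro Max_in) auto
  moreover have "real (length (path v)) \<le> d" if "v \<in> T" for v
  proof -
    \<comment> \<open>An \<open>awalk\<close> starts inside the graph by definition, so nothing
      about \<open>pos\<close> has to be carried through a run.\<close>
    have "pos (g v) \<in> verts G"
      using walk[OF that] unfolding shortest_walk_def pre_digraph.awalk_def by blast
    then have "ereal (real (length (path v))) \<le> diameter G"
      using walk[OF that] distance_le_diameter[of "pos (g v)" G v] that assms(2)
      unfolding shortest_walk_def by auto
    then show ?thesis using assms(4) by simp
  qed
  ultimately show ?thesis using assms(5) by auto
qed

section \<open>Lower bound on \<open>f\<close> and weights of blocks\<close>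

text \<open>A single vertex has no separator of size 0: both sides would hold at most 2/3 of a
  vertex, hence be empty. The bound makes division by \<open>f n\<close> harmless and empty blocks
  small.\<close>

lemma separable_ge_1:
  assumes "\<forall>G \<in> \<C>. graph G" "hereditary \<C>" "separable f \<C>" "G \<in> \<C>" "verts G \<noteq> {}"
  shows "1 \<le> f (card (verts G))"
proof -
  let ?P = "\<lambda>s. \<forall>H. graph H \<and> subgraph H G \<longrightarrow> (\<exists>S. separator H (real s) (2/3) S)"
  interpret graph G using assms(1,4) by blast
  \<comment> \<open>\<open>LEAST\<close> attains its property only if some value has it; taking all
    vertices as separator provides one.\<close>
  have "?P (card (verts G))"
  proof (intro allI impI)
    fix H assume "graph H \<and> subgraph H G"
    then have "card (verts H) \<le> card (verts G)"
      by (auto simp: subgraph_def intro: card_mono)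
    then have "separation H (real (card (verts G))) (2/3) {} {} (verts H)"
      unfolding separation_def by simp
    then show "\<exists>S. separator H (real (card (verts G))) (2/3) S"
      unfolding separator_def by blast
  qed
  then have least: "?P (separation_number G)"
    unfolding separation_number_def by (rule LeastI)
  obtain v where v: "v \<in> verts G" using assms(5) by blast
  have "graph (G \<restriction> {v})" "subgraph (G \<restriction> {v}) G"
    using assms(1,2,4) v unfolding hereditary_def by (blast, simp add: subgraph_induce_subgraphI)
  with least obtain A B S where
    sep: "separation (G \<restriction> {v}) (real (separation_number G)) (2/3) A B S"
    unfolding separator_def by blast
  have "separation_number G \<noteq> 0"
  proof
    assume "separation_number G = 0"
    have AB: "{v} = A \<union> B \<union> S" and "card S = 0" and A: "real (card A) \<le> 2/3" and B: "real (card B) \<le> 2/3"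
      using sep \<open>separation_number G = 0\<close> unfolding separation_def by auto
    have "finite A" "finite B" "finite S" using AB by (metis finite.emptyI finite.insertI finite_Un)+
    moreover have "card A = 0" "card B = 0" using A B by linarith+
    ultimately show False using AB \<open>card S = 0\<close> by simp
  qed
  moreover have "real (separation_number G) \<le> f (card (verts G))"
    using assms(3,4) unfolding separable_def by blast
  ultimately show ?thesis by linarith
qed

text \<open>For \<open>m > s\<close> the recursion tree has at most \<open>3 m / s - 1\<close> inner nodes, whatever the sizes of
  the separators. This is where the constant \<open>6\<close> comes from.\<close>

definition node_bound :: "real \<Rightarrow> nat \<Rightarrow> real" where
  "node_bound s m = (if real m \<le> s then 1 else 6 * real m / s - 1)"

text \<open>Two small parts leave slack, and two large ones need only \<open>a + b \<le> m\<close>.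
  If just \<open>a\<close> exceeds \<open>s\<close>, the claim becomes
  \<open>6 * (m - a) / s \<ge> 2\<close>, which follows from
  \<open>m - a \<ge> m / 3 > s / 3\<close>; this mixed case fixes the 6.\<close>

lemma node_bound_split:
  assumes "0 < s" "s < real m" "a + b \<le> m" "real a \<le> 2/3 * real m" "real b \<le> 2/3 * real m"
  shows "1 + node_bound s a + node_bound s b \<le> node_bound s m"
proof -
  have "real a + real b \<le> real m" using assms(3) by linarith
  then have "node_bound s a * s + node_bound s b * s + s \<le> node_bound s m * s"
    using assms unfolding node_bound_def by (auto simp: algebra_simps)
  then have "(1 + node_bound s a + node_bound s b) * s \<le> node_bound s m * s"
    by (simp add: algebra_simps)
  then show ?thesis using assms(1) by simp
qed

section \<open>Stacks, enclosed blocks and guarded separators\<close>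

definition verts_of :: "'a stack \<Rightarrow> 'a set" where
  "verts_of st = \<Union> (fst ` set st)"

lemma verts_of_simps [simp]:
  "verts_of [] = {}" "verts_of ((U, w) # st) = U \<union> verts_of st"
  "verts_of (st @ st') = verts_of st \<union> verts_of st'"
  unfolding verts_of_def by auto

text \<open>Popping either stops within \<open>L'\<close>, leaving all of \<open>SC\<close>, or
  continues in \<open>SC\<close> as if \<open>L'\<close> were absent.\<close>

lemma kept_append: "\<exists>L. kept p (L' @ SC) = L @ kept p SC"
  unfolding kept_def dropWhile_append
  by (metis append.assoc append_Nil takeWhile_dropWhile_id)

lemma verts_of_kept: "verts_of (kept p SC) \<subseteq> verts_of SC"
  unfolding kept_def verts_of_def by (meson Sup_subset_mono image_mono set_dropWhileD subsetI)

text \<open>The recursion passes on the reduced stack because Stack-C has already been popped for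
  the upper blocks when a deeper one is reached: each block must be closed off by separators that
  survive until then.\<close>

fun enclosed :: "('a, 'b) pre_digraph \<Rightarrow> 'a stack \<Rightarrow> 'a stack \<Rightarrow> bool" where
  "enclosed G [] SC \<longleftrightarrow> True"
| "enclosed G ((U, w) # SB) SC \<longleftrightarrow>
     (\<forall>x \<in> U. \<forall>y. x \<rightarrow>\<^bsub>G\<^esub> y \<longrightarrow> y \<in> U \<union> verts_of (kept (butlast w) SC)) \<and>
     enclosed G SB (kept (butlast w) SC)"

text \<open>Even if an index occurred twice on Stack-C, only more separators would be kept, so the
  order and the values of the indices need not be tracked.\<close>

lemma enclosed_append: "enclosed G SB SC \<Longrightarrow> enclosed G SB (L @ SC)"
proof (induction SB arbitrary: SC L)
  case (Cons Uw SB)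
  obtain U w where [simp]: "Uw = (U, w)" by force
  obtain L' where "kept (butlast w) (L @ SC) = L' @ kept (butlast w) SC"
    using kept_append by blast
  then show ?case using Cons by auto
qed simp

lemma enclosed_exit:
  assumes "enclosed G SB SC" "x \<in> verts_of SB" "x \<rightarrow>\<^bsub>G\<^esub> y"
  shows "y \<in> verts_of SB \<union> verts_of SC"
  using assms
proof (induction SB arbitrary: SC)
  case (Cons Uw SB)
  obtain U w where [simp]: "Uw = (U, w)" by force
  have "y \<in> U \<union> verts_of SB \<union> verts_of (kept (butlast w) SC)"
    using Cons.prems Cons.IH[of "kept (butlast w) SC"] by auto
  then show ?case using verts_of_kept[of "butlast w" SC] by auto
qed simp

text \<open>Disjointness is by position in the list: empty blocks may recur, but a nonempty set may
  not occur twice, which a condition on distinct members would allow.\<close>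

definition disjoint_sets_list :: "'a stack \<Rightarrow> bool" where
  "disjoint_sets_list st \<longleftrightarrow> sorted_wrt (\<lambda>(U, _) (U', _). U \<inter> U' = {}) st"

lemma disjoint_sets_list_simps [simp]:
  "disjoint_sets_list []"
  "disjoint_sets_list ((U, w) # st) \<longleftrightarrow> U \<inter> verts_of st = {} \<and> disjoint_sets_list st"
  "disjoint_sets_list (st @ st') \<longleftrightarrow>
     disjoint_sets_list st \<and> disjoint_sets_list st' \<and> verts_of st \<inter> verts_of st' = {}"
  unfolding disjoint_sets_list_def verts_of_def sorted_wrt_append by (simp, force, force)

text \<open>Guards are taken from \<open>Q\<close> because a placement moves only cops outside
  \<open>Q\<close>.\<close>

definition guarded :: "nat \<Rightarrow> nat set \<Rightarrow> 'a config \<Rightarrow> 'a stack \<Rightarrow> bool" where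
  "guarded k Q pos SC \<longleftrightarrow> (\<forall>v \<in> verts_of SC. \<exists>c \<in> Q. c < k \<and> pos c = v)"

text \<open>\<open>stationed\<close> releases cops according to where they stand, so a guard
  survives because her vertex, by disjointness, lies in no popped separator.\<close>

lemma guarded_kept:
  assumes "guarded k Q pos SC" "disjoint_sets_list SC"
  shows "guarded k (stationed p SC Q pos) pos (kept p SC)"
  unfolding guarded_def
proof
  fix v assume v: "v \<in> verts_of (kept p SC)"
  let ?D = "takeWhile (\<lambda>(S, w'). w' \<noteq> p) SC"
  have SC: "SC = ?D @ kept p SC" unfolding kept_def by simp
  then have "verts_of ?D \<inter> verts_of (kept p SC) = {}"
    using assms(2) by (metis disjoint_sets_list_simps(3))
  then have "v \<notin> verts_of ?D" using v by blast
  moreover obtain c where "c \<in> Q" "c < k" "pos c = v"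
    using assms(1) v verts_of_kept[of p SC] unfolding guarded_def by blast
  ultimately have "c \<in> stationed p SC Q pos"
    unfolding stationed_def verts_of_def by force
  then show "\<exists>c \<in> stationed p SC Q pos. c < k \<and> pos c = v"
    using \<open>c < k\<close> \<open>pos c = v\<close> by blast
qed

lemma disjoint_sets_list_kept:
  "disjoint_sets_list SC \<Longrightarrow> disjoint_sets_list (kept p SC)"
  unfolding kept_def
  by (metis disjoint_sets_list_simps(3) takeWhile_dropWhile_id)

lemma guarded_placement:
  assumes "placement G k Q pos T g ps" "guarded k Q pos SC"
  shows "guarded k Q (last (pos # ps)) SC"
proof -
  have "last (pos # ps) c = pos c" if "c \<in> Q" for c
  proof -
    have "c \<notin> g ` T" using assms(1) that unfolding placement_def by blast
    then have "((pos # ps) ! length ps) c = pos c" using placement_idle[OF assms(1)] by blast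
    then show ?thesis by (simp add: last_conv_nth[of "pos # ps"] del: last.simps)
  qed
  then show ?thesis using assms(2) unfolding guarded_def by simp
qed

lemma guarded_placement_insert:
  assumes "wf_digraph G" "placement G k Q pos T g ps" "guarded k Q pos SC" "finite T"
  shows "guarded k (Q \<union> g ` T) (last (pos # ps)) ((T, w) # SC)"
proof -
  have "g v < k" if "v \<in> T" for v
    using assms(2) that unfolding placement_def by blast
  then show ?thesis
    using guarded_placement[OF assms(2,3)] placement_target[OF assms(1,4,2)]
    unfolding guarded_def by (auto simp del: last.simps)
qed

text \<open>The final configuration of the placement doubles as the initial one of the remaining
  run, so rounds shift by exactly \<open>length ps\<close>.\<close>

lemma captured_in_append:
  assumes "captured_in k (last (pos # ps) # qs) (\<lambda>t. r (t + length ps)) t"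
  shows "captured_in k (pos # ps @ qs) r (t + length ps)"
proof -
  have "(pos # ps @ qs) ! (t + length ps) = (last (pos # ps) # qs) ! t"
    by (cases t; cases ps rule: rev_cases) (auto simp: nth_append nth_Cons')
  then show ?thesis
    using assms unfolding captured_in_def by (cases t) auto
qed

section \<open>Splitting blocks and counting rounds\<close>

locale stt =
  fixes G :: "('a, 'b) pre_digraph" and f :: "nat \<Rightarrow> real"
    and \<S> :: "('a, 'b) pre_digraph \<Rightarrow> 'a set \<times> 'a set \<times> 'a set" and k :: nat
  assumes graph_G: "graph G"
    and f_pos: "0 < f (card (verts G))"
    and separates: "\<lbrakk>U \<noteq> {}; U \<subseteq> verts G; \<S> (G \<restriction> U) = (A, B, C)\<rbrakk>
      \<Longrightarrow> \<exists>s. separation (G \<restriction> U) s (2/3) A B C"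
begin

sublocale graph G by (rule graph_G)

lemma split_block:
  assumes "\<not> real (card U) \<le> f (card (verts G))" "U \<subseteq> verts G" "\<S> (G \<restriction> U) = (A, B, C)"
  shows "U = A \<union> B \<union> C" "A \<inter> B = {}" "A \<inter> C = {}" "B \<inter> C = {}"
    and "real (card A) \<le> 2/3 * real (card U)" "real (card B) \<le> 2/3 * real (card U)"
    and "\<lbrakk>a \<in> A; b \<in> B\<rbrakk> \<Longrightarrow> \<not> a \<rightarrow>\<^bsub>G\<^esub> b" "\<lbrakk>a \<in> A; b \<in> B\<rbrakk> \<Longrightarrow> \<not> b \<rightarrow>\<^bsub>G\<^esub> a"
proof -
  \<comment> \<open>Since \<open>f n\<close> is positive, the empty block counts as small and is
    never split.\<close>
  have "U \<noteq> {}" using assms(1) f_pos by auto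
  then obtain s where sep: "separation (G \<restriction> U) s (2/3) A B C"
    using separates assms(2,3) by blast
  then show "U = A \<union> B \<union> C" "A \<inter> B = {}" "A \<inter> C = {}" "B \<inter> C = {}"
    "real (card A) \<le> 2/3 * real (card U)" "real (card B) \<le> 2/3 * real (card U)"
    unfolding separation_def by auto
  have in_U: "x \<rightarrow>\<^bsub>G \<restriction> U\<^esub> y" if "x \<rightarrow>\<^bsub>G\<^esub> y" "x \<in> U" "y \<in> U" for x y
    using that by (auto simp: arcs_ends_def arc_to_ends_def)
  show "\<not> a \<rightarrow>\<^bsub>G\<^esub> b" "\<not> b \<rightarrow>\<^bsub>G\<^esub> a" if "a \<in> A" "b \<in> B" for a b
    using sep in_U that \<open>U = A \<union> B \<union> C\<close> unfolding separation_def by blast+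
qed

lemma stt_run_length:
  assumes "stt_run G f \<S> k st rs" "verts_of (fst st) \<subseteq> verts G"
    and "diameter G = ereal d" "0 \<le> d"
  shows "real (length rs) \<le>
    d * (\<Sum>(U, w) \<leftarrow> fst st. node_bound (f (card (verts G))) (card U))"
  using assms(1,2)
proof induction
  case (step st ps st' qs)
  let ?s = "f (card (verts G))"
  let ?b = "\<lambda>SB. \<Sum>(U, w) \<leftarrow> SB. node_bound ?s (card U)"
  note len = placement_length[OF _ _ _ assms(3,4)]
  \<comment> \<open>The drop in potential pays for the rounds at \<open>d\<close> per unit. The
    inclusion is proved alongside because the induction hypothesis needs it for the new
    stack.\<close>
  have "real (length ps) + d * ?b (fst st') \<le> d * ?b (fst st) \<and> verts_of (fst st') \<subseteq> verts G"
    using step.hyps(1)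
  proof cases
    case (small U w SC Q pos g SB)
    then have U: "U \<subseteq> verts G" using step.prems by simp
    then have "real (length ps) \<le> d"
      using len[OF _ _ small(4)] finite_subset[OF U] by simp
    then show ?thesis
      using small step.prems by (simp add: node_bound_def algebra_simps)
  next
    case (large U A B C w SC Q pos g SB)
    then have U: "U \<subseteq> verts G" using step.prems by simp
    have big: "\<not> real (card U) \<le> ?s" using large(3) by simp
    note split = split_block[OF big U large(4)]
    have fin: "finite A" "finite B" "finite C" using split(1) U finite_subset[of _ "verts G"] by auto
    have "card A + card B = card (A \<union> B)" using fin split(2) by (simp add: card_Un_disjoint)
    also have "\<dots> \<le> card U" using split(1) fin by (intro card_mono) auto
    finally have "1 + node_bound ?s (card A) + node_bound ?s (card B) \<le> node_bound ?s (card U)"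
      using node_bound_split f_pos big split(5,6) by auto
    then have "d * (1 + node_bound ?s (card A) + node_bound ?s (card B)) \<le> d * node_bound ?s (card U)"
      using assms(4) mult_left_mono by blast
    moreover have "real (length ps) \<le> d"
      using len[OF _ _ large(5)] fin split(1) U by simp
    ultimately show ?thesis
      using large(1,2) step.prems split(1) by (auto simp: algebra_simps)
  qed
  then show ?case using step.IH by simp
qed simp

section \<open>Confinement and capture of the robber\<close>

definition invar :: "'a state \<Rightarrow> bool" where
  "invar st \<longleftrightarrow> (case st of (SB, SC, Q, pos) \<Rightarrow>
     verts_of SB \<subseteq> verts G \<and> disjoint_sets_list (SB @ SC) \<and> enclosed G SB SC \<and>
     guarded k Q pos SC)"

lemma invar_step:
  assumes "stt_step G f \<S> k (SB, SC, Q, pos) ps (SB', SC', Q', pos')" "invar (SB, SC, Q, pos)"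
  shows "invar (SB', SC', Q', pos')"
  using assms(1)
proof cases
  case (small U w g)
  have "guarded k (stationed (butlast w) SC Q pos) pos (kept (butlast w) SC)"
    using guarded_kept assms(2) unfolding invar_def by auto
  then have "guarded k Q' pos' SC'"
    using guarded_placement[OF small(6)] small by simp
  then show ?thesis
    using assms(2) small disjoint_sets_list_kept[of SC "butlast w"]
      verts_of_kept[of "butlast w" SC]
    unfolding invar_def by auto
next
  case (large U A B C w g SB0)
  have inv: "U \<subseteq> verts G" "disjoint_sets_list ((U, w) # SB0 @ SC)"
    "enclosed G ((U, w) # SB0) SC" "guarded k Q pos SC" "verts_of SB0 \<subseteq> verts G"
    using assms(2) large unfolding invar_def by auto
  have big: "\<not> real (card U) \<le> f (card (verts G))" using large by simp
  note split = split_block[OF big inv(1) large(7)]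
  let ?K = "kept (butlast w) SC"
  have K: "verts_of ?K \<subseteq> verts_of SC" "disjoint_sets_list ?K"
    using verts_of_kept[of "butlast w" SC] disjoint_sets_list_kept[of SC "butlast w"] inv(2) by auto
  have "finite C" using split(1) inv(1) finite_subset[of C "verts G"] by auto
  moreover have "guarded k (stationed (butlast w) SC Q pos) pos ?K"
    using guarded_kept inv by auto
  ultimately have "guarded k Q' pos' SC'"
    using guarded_placement_insert[OF wf_digraph_axioms large(8)] large by simp
  moreover have "enclosed G SB' SC'"
  proof -
    have "enclosed G SB0 ((C, w) # ?K)"
      using enclosed_append[of G SB0 ?K "[(C, w)]"] inv(3) by simp
    \<comment> \<open>The indices of \<open>A\<close> and \<open>B\<close> both have
      \<open>butlast\<close> equal to \<open>w\<close>, the index of \<open>C\<close>, so neither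
      block causes a pop.\<close>
    moreover have "kept w ((C, w) # ?K) = (C, w) # ?K" unfolding kept_def by simp
    moreover have "y \<in> A \<union> C \<union> verts_of ?K" if "x \<in> A" "x \<rightarrow>\<^bsub>G\<^esub> y" for x y
      using inv(3) split(1) split(7)[of x y] that by auto
    moreover have "y \<in> B \<union> C \<union> verts_of ?K" if "x \<in> B" "x \<rightarrow>\<^bsub>G\<^esub> y" for x y
      using inv(3) split(1) split(8)[of y x] that by auto
    ultimately show ?thesis using large by auto
  qed
  moreover have "disjoint_sets_list (SB' @ SC')" "verts_of SB' \<subseteq> verts G"
    using large inv K split(1-4) by auto
  ultimately show ?thesis unfolding invar_def by simp
qed

text \<open>The first step out of the blocks would end on a kept separator, whose guard stands still
  throughout the placement and catches the robber in that round.\<close>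

lemma stays_enclosed:
  assumes inv: "invar ((U, w) # SB, SC, Q, pos)"
    and pl: "placement G k (stationed (butlast w) SC Q pos) pos T g ps"
    and move: "\<And>t. r (Suc t) = r t \<or> r t \<rightarrow>\<^bsub>G\<^esub> r (Suc t)"
    and start: "r 0 \<in> verts_of ((U, w) # SB)"
    and free: "\<nexists>t. captured_in k (pos # ps @ qs) r t"
    and "j \<le> length ps"
  shows "r j \<in> verts_of ((U, w) # SB)"
  using assms(6)
proof (induction j)
  case (Suc j)
  let ?K = "kept (butlast w) SC" and ?Q = "stationed (butlast w) SC Q pos"
  have IH: "r j \<in> verts_of ((U, w) # SB)" using Suc by simp
  show ?case
  proof (rule ccontr)
    assume out: "r (Suc j) \<notin> verts_of ((U, w) # SB)"
    then have "r j \<rightarrow>\<^bsub>G\<^esub> r (Suc j)" using IH move[of j] by auto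
    then have "r (Suc j) \<in> verts_of ?K"
      using IH out inv enclosed_exit[of G SB ?K "r j" "r (Suc j)"] unfolding invar_def by auto
    moreover have "guarded k ?Q pos ?K"
      using guarded_kept inv unfolding invar_def by auto
    ultimately obtain c where c: "c \<in> ?Q" "c < k" "pos c = r (Suc j)"
      unfolding guarded_def by blast
    have "c \<notin> g ` T" using pl c(1) unfolding placement_def by blast
    then have "((pos # ps) ! Suc j) c = r (Suc j)"
      using placement_idle[OF pl _ Suc.prems] c(3) by simp
    then have "captured_in k (pos # ps @ qs) r (Suc j)"
      using c(2) Suc.prems unfolding captured_in_def by (auto simp: nth_append)
    then show False using free by blast
  qed
qed (use start in simp)

text \<open>The robber may cross \<open>T\<close> while the cops are walking; only at the end of the
  placement are all targets occupied at once.\<close>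

lemma avoids_targets:
  assumes pl: "placement G k Q pos T g ps" "finite T"
    and free: "\<nexists>t. captured_in k (pos # ps @ qs) r t"
  shows "r (length ps) \<notin> T"
proof
  assume T: "r (length ps) \<in> T"
  have "(pos # ps @ qs) ! length ps = last (pos # ps)"
    by (metis append_Cons last_conv_nth length_Cons diff_Suc_1 lessI list.distinct(1) nth_append)
  then have "((pos # ps @ qs) ! length ps) (g (r (length ps))) = r (length ps)"
    using placement_target[OF wf_digraph_axioms pl(2,1) T] by simp
  moreover have "g (r (length ps)) < k"
    using pl(1) T unfolding placement_def by blast
  ultimately have "captured_in k (pos # ps @ qs) r (length ps)"
    unfolding captured_in_def by auto
  then show False using free by blast
qed

text \<open>If a placement fails to catch the robber, he ends it in a block of the new Stack-B, and
  the induction hypothesis applies to his play shifted by \<open>length ps\<close>; hence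
  \<open>r\<close> is arbitrary. With Stack-B empty the start assumption is contradictory.\<close>

lemma stt_run_captures:
  assumes "stt_run G f \<S> k st rs" "invar st"
    and "\<And>t. r (Suc t) = r t \<or> r t \<rightarrow>\<^bsub>G\<^esub> r (Suc t)"
    and "r 0 \<in> verts_of (fst st)"
  shows "\<exists>t. captured_in k (snd (snd (snd st)) # rs) r t"
  using assms
proof (induction arbitrary: r)
  case (step st ps st' qs)
  obtain SB SC Q pos where st: "st = (SB, SC, Q, pos)" by (cases st)
  obtain SB' SC' Q' pos' where st': "st' = (SB', SC', Q', pos')" by (cases st')
  show ?case
  proof (rule ccontr)
    assume "\<not> ?thesis"
    then have free: "\<nexists>t. captured_in k (pos # ps @ qs) r t" using st by simp
    have "pos' = last (pos # ps) \<and> r (length ps) \<in> verts_of SB'"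
      using step.hyps(1) unfolding st st'
    proof cases
      case (small U w g)
      have U: "finite U" "U \<subseteq> verts G" using step.prems(1) st small finite_subset[of U "verts G"]
        unfolding invar_def by auto
      have "r (length ps) \<in> verts_of ((U, w) # SB')"
        using stays_enclosed[OF _ small(6) step.prems(2) _ free, where SB = SB' and j = "length ps"]
          step.prems(1,3) st small by simp
      moreover have "r (length ps) \<notin> U"
        using avoids_targets[OF small(6) _ free] U by simp
      ultimately show ?thesis using small by simp
    next
      case (large U A B C w g SB0)
      have U: "finite U" "U \<subseteq> verts G" using step.prems(1) st large finite_subset[of U "verts G"]
        unfolding invar_def by auto
      have big: "\<not> real (card U) \<le> f (card (verts G))" using large by simp
      note split = split_block[OF big U(2) large(7)]
      have "r (length ps) \<in> verts_of ((U, w) # SB0)"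
        using stays_enclosed[OF _ large(8) step.prems(2) _ free, where SB = SB0 and j = "length ps"]
          step.prems(1,3) st large by simp
      moreover have "r (length ps) \<notin> C"
        using avoids_targets[OF large(8) _ free] U split(1) by simp
      ultimately show ?thesis using large split(1) by auto
    qed
    moreover have "invar st'" using invar_step step.hyps(1) step.prems(1) unfolding st st' by blast
    ultimately obtain t where
      "captured_in k (last (pos # ps) # qs) (\<lambda>t. r (t + length ps)) t"
      using step.IH[of "\<lambda>t. r (t + length ps)"] step.prems(2) unfolding st' by auto
    then show False using captured_in_append free by blast
  qed
qed auto

section \<open>Bounds on the capture time\<close>

lemma capture_time_le:
  assumes "stt_strategy G f \<S> k \<sigma>"
  shows "capture_time G k \<sigma> \<le> enat (length \<sigma> - 1)"
proof -
  obtain pos st qs where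
    first: "stt_step G f \<S> k ([(verts G, [])], [], {}, pos) [] st"
    and run: "stt_run G f \<S> k st qs" and \<sigma>: "\<sigma> = pos # qs"
    using assms unfolding stt_strategy_def by blast
  let ?init = "([(verts G, [])], [], {}, pos)"
  \<comment> \<open>The first iteration contributes no configurations, so prefixing it leaves
    \<open>qs\<close> unchanged and lets the run start from the simple initial state.\<close>
  have whole: "stt_run G f \<S> k ?init qs" using stt_run.step[OF first run] by simp
  have inv: "invar ?init"
    unfolding invar_def guarded_def by (auto simp: adj_in_verts)
  have "(INF t \<in> {t. captured_in k \<sigma> r t}. enat t) \<le> enat (length \<sigma> - 1)"
    if "robber_play G r" for r
  proof -
    have "\<exists>t. captured_in k \<sigma> r t"
      using stt_run_captures[OF whole inv, of r] that \<sigma> unfolding robber_play_def by simp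
    then obtain t where t: "captured_in k \<sigma> r t" ..
    have "t \<le> length \<sigma> - 1" using t unfolding captured_in_def by linarith
    then show ?thesis using t by (intro INF_lower2[of t]) auto
  qed
  then show ?thesis unfolding capture_time_def by (auto intro: SUP_least)
qed

lemma stt_strategy_length:
  assumes "stt_strategy G f \<S> k \<sigma>" and "diameter G = ereal d" "0 \<le> d"
  shows "real (length \<sigma> - 1) \<le> 6 * (d * (real (card (verts G)) / f (card (verts G))))"
proof -
  let ?n = "card (verts G)"
  obtain pos st qs where
    first: "stt_step G f \<S> k ([(verts G, [])], [], {}, pos) [] st"
    and run: "stt_run G f \<S> k st qs" and \<sigma>: "\<sigma> = pos # qs"
    using assms unfolding stt_strategy_def by blast
  show ?thesis
  proof (cases "real ?n \<le> f ?n")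
    \<comment> \<open>Here the weight is 1 while \<open>n / f n\<close> may be arbitrarily small, so
      the potential is too coarse; the free first placement already empties Stack-B.\<close>
    case True
    have "fst st = []"
      using first by (rule stt_step.cases) (use True in simp_all)
    from run this have "qs = []"
    proof (cases rule: stt_run.cases)
      case (step ps st' qs')
      from step(2) \<open>fst st = []\<close> show ?thesis by (cases rule: stt_step.cases) simp_all
    qed simp
    then show ?thesis using \<sigma> assms(3) f_pos by simp
  next
    case False
    have "stt_run G f \<S> k ([(verts G, [])], [], {}, pos) qs" using stt_run.step[OF first run] by simp
    then have "real (length qs) \<le> d * node_bound (f ?n) ?n"
      using stt_run_length[OF _ _ assms(2,3), of "([(verts G, [])], [], {}, pos)" qs] by simp
    also have "\<dots> \<le> d * (6 * (real ?n / f ?n))"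
      using False assms(3) unfolding node_bound_def by (intro mult_left_mono) auto
    finally show ?thesis using \<sigma> by (simp add: mult.left_commute)
  qed
qed

end

theorem theorem3:
  shows "\<exists>K :: real. \<forall>(\<C> :: ('a, 'b) pre_digraph set) (f :: nat \<Rightarrow> real).
           (\<forall>G \<in> \<C>. graph G) \<and> hereditary \<C> \<and> separable f \<C> \<longrightarrow>
           (\<forall>\<S>. separation_algorithm \<C> f \<S> \<longrightarrow>
             (\<forall>G \<in> \<C>. \<forall>n k \<sigma>. n = card (verts G) \<and> stt_strategy G f \<S> k \<sigma> \<longrightarrow>
                ereal_of_enat (capture_time G k \<sigma>)
                  \<le> ereal K * (diameter G * ereal (real n / f n))))"
proof (intro exI[of _ 6] allI impI ballI)
  fix \<C> :: "('a, 'b) pre_digraph set" and f :: "nat \<Rightarrow> real" and \<S> G n k \<sigma>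
  assume \<C>: "(\<forall>G \<in> \<C>. graph G) \<and> hereditary \<C> \<and> separable f \<C>"
    and \<S>: "separation_algorithm \<C> f \<S>" and G: "G \<in> \<C>"
    and n\<sigma>: "n = card (verts G) \<and> stt_strategy G f \<S> k \<sigma>"
  interpret graph G using \<C> G by blast
  have n: "n = card (verts G)" and \<sigma>: "stt_strategy G f \<S> k \<sigma>" using n\<sigma> by auto
  show "ereal_of_enat (capture_time G k \<sigma>) \<le> ereal 6 * (diameter G * ereal (real n / f n))"
  proof (cases "verts G = {}")
    \<comment> \<open>Without vertices there is no play and the supremum is 0. The diameter is then
      an empty supremum, but it is multiplied by 0.\<close>
    case True
    then have "{r. robber_play G r} = {}" unfolding robber_play_def by auto
    then have "capture_time G k \<sigma> = 0"
      unfolding capture_time_def by (simp only: image_empty Sup_empty bot_enat_def)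
    moreover have "ereal (real n / f n) = 0" using True n by (simp add: zero_ereal_def)
    ultimately show ?thesis by (simp only:) simp
  next
    case False
    have "1 \<le> f n" using separable_ge_1[of \<C> f G] \<C> G False n by simp
    interpret stt G f \<S> k
    proof
      fix U A B C assume "U \<noteq> {}" "U \<subseteq> verts G" and eq: "\<S> (G \<restriction> U) = (A, B, C)"
      then have "G \<restriction> U \<in> \<C>" using \<C> G unfolding hereditary_def by blast
      then show "\<exists>s. separation (G \<restriction> U) s (2/3) A B C"
        using \<S> eq unfolding separation_algorithm_def by fastforce
    qed (use \<open>1 \<le> f n\<close> n graph_axioms in auto)
    have "0 \<le> diameter G"
    proof -
      obtain v where "v \<in> verts G" using False by blast
      then show ?thesis
        using distance_nonneg[of v v] distance_le_diameter[of v G v] by simp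
    qed
    \<comment> \<open>Positivity makes the right-hand side infinite when the diameter is.\<close>
    have pos: "0 < real n / f n"
      using False n \<open>1 \<le> f n\<close> by (simp add: card_gt_0_iff)
    show ?thesis
    proof (cases "diameter G")
      case (real d)
      have "ereal_of_enat (capture_time G k \<sigma>) \<le> ereal_of_enat (enat (length \<sigma> - 1))"
        using capture_time_le[OF \<sigma>] by (simp only: ereal_of_enat_le_iff)
      also have "\<dots> \<le> ereal (6 * (d * (real n / f n)))"
        using stt_strategy_length[OF \<sigma> real] \<open>0 \<le> diameter G\<close> real n by simp
      finally show ?thesis using real by simp
    qed (use pos \<open>0 \<le> diameter G\<close> in auto)
  qed
qed

end
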